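(* Let $\mathbf{A}$ be a finite algebra with the universe $\{1,2,\dots,|A|\}$ and with finitely many basic operations. Let $m\geq 1$ be the maximal arity of a basic operation of $\mathbf{A}$. Then $\mathbf{A}$ has a cube term if and only if $\mathbf{A}$ has a cube term of dimension at most $|A|^3m$.
   Context: The algebra is not assumed to be idempotent. Write $[n]=\{1,\dots,n\}$. For $\mathbf{a},\mathbf{b}\in A^n$ and $I\subseteq[n]$, let $\chi_I(\mathbf{a},\mathbf{b})\in A^n$ be the tuple whose $i$-th entry is $b_i$ if $i\in I$ and $a_i$ if $i\notin I$. Term operations are the members of the clone generated by the basic operations. A cube term of dimension $d$ of $\mathbf{A}$ is a $(2^d-1)$-ary term operation $t$ of $\mathbf{A}$, with arguments indexed by the nonempty subsets of $[d]$, such that $t(\chi_I(\mathbf{a},\mathbf{b})\colon \emptyset\neq I\subseteq[d])=\mathbf{a}$ for all $\mathbf{a},\mathbf{b}\in A^d$ ($t$ applied coordinatewise). "Has a cube term" means has a cube term of some dimension. *)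

theory Defs
  imports Main "HOL-Library.FuncSet"
begin

(* Tuples in A^n and n-ary operations on A are extensional functions, so that equality of
   HOL functions is equality of tuples and of operations. *)
definition tuples :: "'a set \<Rightarrow> nat \<Rightarrow> (nat \<Rightarrow> 'a) set" where
  "tuples A n = {1..n} \<rightarrow>\<^sub>E A"

definition operations :: "'a set \<Rightarrow> nat \<Rightarrow> ((nat \<Rightarrow> 'a) \<Rightarrow> 'a) set" where
  "operations A n = tuples A n \<rightarrow>\<^sub>E A"

(* The basic operations form a family indexed by S; nullary operations are allowed and
   no idempotence is required. *)
definition is_algebra ::
  "'a set \<Rightarrow> 's set \<Rightarrow> ('s \<Rightarrow> nat) \<Rightarrow> ('s \<Rightarrow> (nat \<Rightarrow> 'a) \<Rightarrow> 'a) \<Rightarrow> bool" where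
  "is_algebra A S ar f \<longleftrightarrow> A \<noteq> {} \<and> (\<forall>s\<in>S. f s \<in> operations A (ar s))"

inductive term_operation ::
  "'a set \<Rightarrow> 's set \<Rightarrow> ('s \<Rightarrow> nat) \<Rightarrow> ('s \<Rightarrow> (nat \<Rightarrow> 'a) \<Rightarrow> 'a) \<Rightarrow> nat \<Rightarrow> ((nat \<Rightarrow> 'a) \<Rightarrow> 'a) \<Rightarrow> bool"
  for A S ar f where
  projection: "i \<in> {1..n} \<Longrightarrow> term_operation A S ar f n (\<lambda>x\<in>tuples A n. x i)"
| basic: "s \<in> S \<Longrightarrow> term_operation A S ar f (ar s) (f s)"
| composition:
    "term_operation A S ar f k g \<Longrightarrow> \<forall>j\<in>{1..k}. term_operation A S ar f n (h j) \<Longrightarrow>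
     term_operation A S ar f n (\<lambda>x\<in>tuples A n. g (\<lambda>j\<in>{1..k}. h j x))"

lemma term_operation_in_operations:
  assumes "is_algebra A S ar f" and "term_operation A S ar f n t"
  shows "t \<in> operations A n"
  using assms(2)
proof (induction rule: term_operation.induct)
  case (projection i n)
  then show ?case unfolding operations_def tuples_def restrict_PiE_iff by (blast intro: PiE_mem)
next
  case (basic s)
  then show ?case using assms(1) by (auto simp: is_algebra_def)
next
  case (composition k g n h)
  have "g (\<lambda>j\<in>{1..k}. h j x) \<in> A" if "x \<in> tuples A n" for x
  proof -
    have "(\<lambda>j\<in>{1..k}. h j x) \<in> tuples A k"
      using composition.IH(2) that unfolding operations_def tuples_def[of A k] restrict_PiE_iff
      by (blast intro: PiE_mem)
    then show ?thesis
      using composition.IH(1) unfolding operations_def by (rule PiE_mem[rotated])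
  qed
  then show ?case unfolding operations_def restrict_PiE_iff by blast
qed

definition chi :: "nat \<Rightarrow> nat set \<Rightarrow> (nat \<Rightarrow> 'a) \<Rightarrow> (nat \<Rightarrow> 'a) \<Rightarrow> (nat \<Rightarrow> 'a)" where
  "chi n I a b = (\<lambda>i\<in>{1..n}. if i \<in> I then b i else a i)"

(* The bijection e indexes the 2^d - 1 arguments of t by the nonempty subsets of {1..d}; its
   choice does not affect the existence of a cube term, as term operations are closed under
   permuting arguments.  The dimension is positive: for d = 0 the identity is void, and any
   nullary term operation would satisfy it. *)
definition cube_term ::
  "'a set \<Rightarrow> 's set \<Rightarrow> ('s \<Rightarrow> nat) \<Rightarrow> ('s \<Rightarrow> (nat \<Rightarrow> 'a) \<Rightarrow> 'a) \<Rightarrow> nat \<Rightarrow> ((nat \<Rightarrow> 'a) \<Rightarrow> 'a) \<Rightarrow> bool" where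
  "cube_term A S ar f d t \<longleftrightarrow>
     d \<ge> 1 \<and> term_operation A S ar f (2 ^ d - 1) t \<and>
     (\<exists>e. bij_betw e {1..2 ^ d - 1} {I. I \<subseteq> {1..d} \<and> I \<noteq> {}} \<and>
        (\<forall>a\<in>tuples A d. \<forall>b\<in>tuples A d.
           (\<lambda>i\<in>{1..d}. t (\<lambda>j\<in>{1..2 ^ d - 1}. chi d (e j) a b i)) = a))"

definition has_cube_term_dim ::
  "'a set \<Rightarrow> 's set \<Rightarrow> ('s \<Rightarrow> nat) \<Rightarrow> ('s \<Rightarrow> (nat \<Rightarrow> 'a) \<Rightarrow> 'a) \<Rightarrow> nat \<Rightarrow> bool" where
  "has_cube_term_dim A S ar f d \<longleftrightarrow> (\<exists>t. cube_term A S ar f d t)"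

definition has_cube_term ::
  "'a set \<Rightarrow> 's set \<Rightarrow> ('s \<Rightarrow> nat) \<Rightarrow> ('s \<Rightarrow> (nat \<Rightarrow> 'a) \<Rightarrow> 'a) \<Rightarrow> bool" where
  "has_cube_term A S ar f \<longleftrightarrow> (\<exists>d. has_cube_term_dim A S ar f d)"

end

theory Submission
  imports Defs
begin

text \<open>
  Consider tuples with a coordinate for every element of a finite set \<open>E\<close> of rows and a further
  coordinate, a parameter, for every element of \<open>A\<close>; the parameters start out as the identity
  tuple and thus keep track of idempotence. Call such a tuple \<open>u\<close> elusive if it is not generated by
  its chipped versions, in which the entries of a nonempty set of rows are replaced by those of
  prescribed parameters. An algebra without an \<open>N\<close>-dimensional cube term has an elusive tuple with
  \<open>N\<close> rows. The point is that an elusive tuple with \<open>N \<ge> |A|\<^sup>3m\<close> rows yields one with \<open>N + 1\<close> rows,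
  so that a cube term of least dimension has dimension at most \<open>|A|\<^sup>3m\<close>.

  Choose \<open>u\<close> such that the subalgebra \<open>R\<close> generated by its chipped versions is as small as possible.
  At least \<open>|A|m\<close> rows share both their entry in \<open>u\<close> and their parameter; duplicate one of them.
  If the new tuple \<open>u'\<close> were not elusive, then in a derivation of \<open>u'\<close> there would be a first tuple
  \<open>x = g(x\<^sub>1, \<dots>, x\<^sub>k)\<close> in which two of these rows \<open>i\<close>, \<open>i'\<close> have equal entries although \<open>x\<close> without
  row \<open>i\<close> is not in \<open>R\<close>. A row whose removal leads out of \<open>R\<close> has an entry in some \<open>x\<^sub>l\<close> that no
  other row has, so there are at most \<open>|A|m\<close> of them and some row \<open>k\<close> can be removed from \<open>x\<close>. Now \<open>x\<close>
  without row \<open>i\<close> is elusive, hence by minimality its chipped versions generate all of \<open>R\<close>, including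
  \<open>u\<close> chipped at row \<open>k\<close>. Copying row \<open>i'\<close> onto row \<open>k\<close> maps these generators into \<open>R\<close>, but
  it maps \<open>u\<close> chipped at row \<open>k\<close> to \<open>u\<close>, a contradiction.
\<close>

subsection \<open>Subpowers\<close>

text \<open>Closure under single basic operations instead of term operations: an induction then
  meets only \<open>ar s\<close> arguments at a time, and this is how the maximal arity enters the
  bound.\<close>

inductive_set generated ::
  "'s set \<Rightarrow> ('s \<Rightarrow> nat) \<Rightarrow> ('s \<Rightarrow> (nat \<Rightarrow> 'a) \<Rightarrow> 'a) \<Rightarrow> 'i set \<Rightarrow> ('i \<Rightarrow> 'a) set \<Rightarrow> ('i \<Rightarrow> 'a) set"
  for S ar f Z G where
  gen: "g \<in> G \<Longrightarrow> g \<in> generated S ar f Z G"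
| app: "s \<in> S \<Longrightarrow> (\<And>l. l \<in> {1..ar s} \<Longrightarrow> h l \<in> generated S ar f Z G) \<Longrightarrow>
    (\<lambda>i\<in>Z. f s (\<lambda>l\<in>{1..ar s}. h l i)) \<in> generated S ar f Z G"

text \<open>Operations act coordinatewise, so permuting, repeating or omitting coordinates along
  \<open>\<rho>\<close> commutes with them.\<close>

lemma generated_reindex:
  assumes "x \<in> generated S ar f Z G" and "\<rho> \<in> Z' \<rightarrow> Z"
    and "\<And>g. g \<in> G \<Longrightarrow> (\<lambda>i\<in>Z'. g (\<rho> i)) \<in> generated S ar f Z' G'"
  shows "(\<lambda>i\<in>Z'. x (\<rho> i)) \<in> generated S ar f Z' G'"
  using assms(1)
proof induction
  case (gen g)
  then show ?case by (rule assms(3))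
next
  case (app s h)
  have "(\<lambda>i\<in>Z'. f s (\<lambda>l\<in>{1..ar s}. (\<lambda>i\<in>Z'. h l (\<rho> i)) i)) \<in> generated S ar f Z' G'"
    using app.hyps(1) app.IH by (rule generated.app)
  also have "(\<lambda>i\<in>Z'. f s (\<lambda>l\<in>{1..ar s}. (\<lambda>i\<in>Z'. h l (\<rho> i)) i)) =
      (\<lambda>i\<in>Z'. (\<lambda>i\<in>Z. f s (\<lambda>l\<in>{1..ar s}. h l i)) (\<rho> i))"
    using assms(2) by (intro restrict_ext) (auto cong: restrict_cong)
  finally show ?case .
qed

lemma generated_subset:
  assumes "G \<subseteq> generated S ar f Z G'"
  shows "generated S ar f Z G \<subseteq> generated S ar f Z G'"
proof
  fix x assume "x \<in> generated S ar f Z G"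
  then show "x \<in> generated S ar f Z G'"
  proof induction
    case (gen g)
    then show ?case using assms by blast
  next
    case (app s h)
    then show ?case by (intro generated.app)
  qed
qed

subsection \<open>Chipped tuples\<close>

lemma Inl_in_Plus_iff [simp]: "Inl x \<in> E <+> B \<longleftrightarrow> x \<in> E"
  by auto

lemma Inr_in_Plus_iff [simp]: "Inr a \<in> E <+> B \<longleftrightarrow> a \<in> B"
  by auto

text \<open>Rows are \<open>Inl\<close>, parameters \<open>Inr\<close>. Chipping is a map of
  coordinates, so that it falls under \<open>generated_reindex\<close>.\<close>

definition shift :: "('e \<Rightarrow> 'a) \<Rightarrow> 'e set \<Rightarrow> 'e + 'a \<Rightarrow> 'e + 'a" where
  "shift \<gamma> I z = (case z of Inl e \<Rightarrow> if e \<in> I then Inr (\<gamma> e) else Inl e | Inr a \<Rightarrow> Inr a)"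

lemma shift_simps [simp]:
  "shift \<gamma> I (Inl e) = (if e \<in> I then Inr (\<gamma> e) else Inl e)"
  "shift \<gamma> I (Inr a) = Inr a"
  by (simp_all add: shift_def)

lemma shift_shift: "shift \<gamma> J (shift \<gamma> I z) = shift \<gamma> (I \<union> J) z"
  by (cases z) auto

text \<open>The family \<open>\<I>\<close> is kept general: it consists of unions of columns at
  first and of all nonempty sets of rows at the end.\<close>

definition chips ::
  "'a set \<Rightarrow> 'e set \<Rightarrow> ('e \<Rightarrow> 'a) \<Rightarrow> 'e set set \<Rightarrow> ('e + 'a \<Rightarrow> 'a) \<Rightarrow> ('e + 'a \<Rightarrow> 'a) set" where
  "chips A E \<gamma> \<I> u = (\<lambda>I. \<lambda>z\<in>E <+> A. u (shift \<gamma> I z)) ` \<I>"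

section \<open>Subpowers and term operations of a fixed algebra\<close>

locale algebra =
  fixes A :: "'a set" and S :: "'s set" and ar :: "'s \<Rightarrow> nat" and f :: "'s \<Rightarrow> (nat \<Rightarrow> 'a) \<Rightarrow> 'a"
  assumes is_algebra: "is_algebra A S ar f"
begin

abbreviation "Sg \<equiv> generated S ar f"

text \<open>The entries of \<open>u\<close> at the parameters need not be the identity: tuples
  produced by non-idempotent operations must qualify too.\<close>

definition elusive :: "'e set \<Rightarrow> ('e \<Rightarrow> 'a) \<Rightarrow> 'e set set \<Rightarrow> ('e + 'a \<Rightarrow> 'a) \<Rightarrow> bool" where
  "elusive E \<gamma> \<I> u \<longleftrightarrow> \<gamma> \<in> E \<rightarrow> A \<and> u \<in> (E <+> A) \<rightarrow>\<^sub>E A \<and> u \<notin> Sg (E <+> A) (chips A E \<gamma> \<I> u)"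

lemma op_closed:
  assumes "s \<in> S" and "\<And>l. l \<in> {1..ar s} \<Longrightarrow> x l \<in> A"
  shows "f s (\<lambda>l\<in>{1..ar s}. x l) \<in> A"
proof -
  have "f s \<in> tuples A (ar s) \<rightarrow>\<^sub>E A"
    using is_algebra assms(1) by (auto simp: is_algebra_def operations_def)
  moreover have "(\<lambda>l\<in>{1..ar s}. x l) \<in> tuples A (ar s)"
    using assms(2) by (auto simp: tuples_def)
  ultimately show ?thesis by (rule PiE_mem)
qed

lemma restrict_in_tuples:
  assumes "\<And>j. j \<in> {1..n} \<Longrightarrow> h j \<in> Z \<rightarrow>\<^sub>E A" and "z \<in> Z"
  shows "(\<lambda>j\<in>{1..n}. h j z) \<in> tuples A n"
  unfolding tuples_def restrict_PiE_iff using assms by blast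

lemma Sg_in_PiE:
  assumes "G \<subseteq> Z \<rightarrow>\<^sub>E A"
  shows "Sg Z G \<subseteq> Z \<rightarrow>\<^sub>E A"
proof
  fix x assume "x \<in> Sg Z G"
  then show "x \<in> Z \<rightarrow>\<^sub>E A"
  proof induction
    case (gen g)
    then show ?case using assms by blast
  next
    case (app s h)
    have "h l i \<in> A" if "l \<in> {1..ar s}" "i \<in> Z" for l i
      using app.IH[OF that(1)] that(2) by (rule PiE_mem)
    then show ?case unfolding restrict_PiE_iff using app.hyps(1) by (blast intro: op_closed)
  qed
qed

lemma Sg_term_operation:
  assumes "term_operation A S ar f n t"
    and G: "G \<subseteq> Z \<rightarrow>\<^sub>E A" and "\<And>j. j \<in> {1..n} \<Longrightarrow> h j \<in> Sg Z G"
  shows "(\<lambda>z\<in>Z. t (\<lambda>j\<in>{1..n}. h j z)) \<in> Sg Z G"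
  using assms(1,3)
proof (induction arbitrary: h)
  case (projection i n)
  have in_PiE: "h j \<in> Z \<rightarrow>\<^sub>E A" if "j \<in> {1..n}" for j
    using projection.prems[OF that] Sg_in_PiE[OF G] by blast
  then have "(\<lambda>j\<in>{1..n}. h j z) \<in> tuples A n" if "z \<in> Z" for z
    using that by (rule restrict_in_tuples)
  then have "(\<lambda>z\<in>Z. (\<lambda>x\<in>tuples A n. x i) (\<lambda>j\<in>{1..n}. h j z)) = h i"
    using projection.hyps in_PiE[OF projection.hyps] by (auto simp: fun_eq_iff PiE_def extensional_def)
  then show ?case using projection.hyps projection.prems by metis
next
  case (basic s)
  then show ?case by (intro generated.app)
next
  case (composition k g n h')
  have in_PiE: "h j \<in> Z \<rightarrow>\<^sub>E A" if "j \<in> {1..n}" for j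
    using composition.prems[OF that] Sg_in_PiE[OF G] by blast
  then have tup: "(\<lambda>j\<in>{1..n}. h j z) \<in> tuples A n" if "z \<in> Z" for z
    using that by (rule restrict_in_tuples)
  have "(\<lambda>z\<in>Z. g (\<lambda>j\<in>{1..k}. (\<lambda>z\<in>Z. h' j (\<lambda>j\<in>{1..n}. h j z)) z)) \<in> Sg Z G"
    using composition.IH(2) composition.prems by (intro composition.IH(1)) blast
  also have "(\<lambda>z\<in>Z. g (\<lambda>j\<in>{1..k}. (\<lambda>z\<in>Z. h' j (\<lambda>j\<in>{1..n}. h j z)) z)) =
      (\<lambda>z\<in>Z. (\<lambda>x\<in>tuples A n. g (\<lambda>j\<in>{1..k}. h' j x)) (\<lambda>j\<in>{1..n}. h j z))"
    using tup by (intro restrict_ext) (auto cong: restrict_cong)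
  finally show ?case .
qed

lemma Sg_imp_term_operation:
  assumes "x \<in> Sg Z (h ` {1..n})" and h: "\<And>j. j \<in> {1..n} \<Longrightarrow> h j \<in> Z \<rightarrow>\<^sub>E A"
  shows "\<exists>t. term_operation A S ar f n t \<and> (\<forall>z\<in>Z. x z = t (\<lambda>j\<in>{1..n}. h j z))"
  using assms(1)
proof induction
  have tup: "(\<lambda>j\<in>{1..n}. h j z) \<in> tuples A n" if "z \<in> Z" for z
    using h that by (rule restrict_in_tuples)
  {
    case (gen g)
    then obtain i where i: "i \<in> {1..n}" "g = h i" by blast
    have "g z = (\<lambda>x\<in>tuples A n. x i) (\<lambda>j\<in>{1..n}. h j z)" if "z \<in> Z" for z
      unfolding restrict_apply'[OF tup[OF that]] using i by simp
    then show ?case using term_operation.projection[OF i(1), of A S ar f] by blast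
  next
    case (app s h')
    have "\<forall>l\<in>{1..ar s}. \<exists>t. term_operation A S ar f n t \<and> (\<forall>z\<in>Z. h' l z = t (\<lambda>j\<in>{1..n}. h j z))"
      using app.IH by (rule ballI)
    from bchoice[OF this] obtain t where
      t: "\<And>l. l \<in> {1..ar s} \<Longrightarrow> term_operation A S ar f n (t l)"
      "\<And>l z. l \<in> {1..ar s} \<Longrightarrow> z \<in> Z \<Longrightarrow> h' l z = t l (\<lambda>j\<in>{1..n}. h j z)"
      by blast
    have "term_operation A S ar f n (\<lambda>x\<in>tuples A n. f s (\<lambda>l\<in>{1..ar s}. t l x))"
      using app.hyps(1) t(1) by (intro term_operation.composition term_operation.basic ballI)
    moreover have "(\<lambda>i\<in>Z. f s (\<lambda>l\<in>{1..ar s}. h' l i)) z =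
        (\<lambda>x\<in>tuples A n. f s (\<lambda>l\<in>{1..ar s}. t l x)) (\<lambda>j\<in>{1..n}. h j z)" if "z \<in> Z" for z
      using that tup t(2) by (auto cong: restrict_cong)
    ultimately show ?case by blast
  }
qed


lemma shift_in_Plus:
  assumes "\<gamma> \<in> E \<rightarrow> A"
  shows "shift \<gamma> I \<in> E <+> A \<rightarrow> E <+> A"
  using assms by (auto split: if_splits)

lemma chips_in_PiE:
  assumes "\<gamma> \<in> E \<rightarrow> A" and "u \<in> (E <+> A) \<rightarrow>\<^sub>E A"
  shows "chips A E \<gamma> \<I> u \<subseteq> (E <+> A) \<rightarrow>\<^sub>E A"
proof
  fix x assume "x \<in> chips A E \<gamma> \<I> u"
  then obtain I where x: "x = (\<lambda>z\<in>E <+> A. u (shift \<gamma> I z))" by (auto simp: chips_def)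
  have "u (shift \<gamma> I z) \<in> A" if "z \<in> E <+> A" for z
    using shift_in_Plus[OF assms(1), of I] assms(2) that by blast
  then show "x \<in> (E <+> A) \<rightarrow>\<^sub>E A" unfolding x restrict_PiE_iff by blast
qed

text \<open>By \<open>shift_shift\<close>, chipping at \<open>I\<close> sends the chip at
  \<open>J\<close> to the chip at \<open>I \<union> J\<close>; \<open>I\<close> itself need not
  belong to \<open>\<I>\<close>.\<close>

lemma chips_closed:
  assumes "x \<in> Sg (E <+> A) (chips A E \<gamma> \<I> u)" and "\<gamma> \<in> E \<rightarrow> A"
    and un: "\<And>J. J \<in> \<I> \<Longrightarrow> I \<union> J \<in> \<I>"
  shows "(\<lambda>z\<in>E <+> A. x (shift \<gamma> I z)) \<in> Sg (E <+> A) (chips A E \<gamma> \<I> u)"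
  using assms(1) shift_in_Plus[OF assms(2)]
proof (rule generated_reindex)
  fix g assume "g \<in> chips A E \<gamma> \<I> u"
  then obtain J where J: "J \<in> \<I>" "g = (\<lambda>z\<in>E <+> A. u (shift \<gamma> J z))" by (auto simp: chips_def)
  have "(\<lambda>z\<in>E <+> A. g (shift \<gamma> I z)) = (\<lambda>z\<in>E <+> A. u (shift \<gamma> (I \<union> J) z))"
    using shift_in_Plus[OF assms(2), of I] unfolding J(2)
    by (intro restrict_ext) (simp add: Pi_iff shift_shift)
  then show "(\<lambda>z\<in>E <+> A. g (shift \<gamma> I z)) \<in> Sg (E <+> A) (chips A E \<gamma> \<I> u)"
    using un[OF J(1)] by (auto simp: chips_def intro: generated.gen)
qed

subsection \<open>Cube terms and elusive tuples\<close>

text \<open>On the rows, the chips of \<open>u\<close> are the tuples \<open>chi\<close> formed from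
  the entries of \<open>u\<close> and those of the parameters, so the cube identity generates
  \<open>u\<close> from them.\<close>

lemma cube_term_imp_not_elusive:
  assumes "has_cube_term_dim A S ar f d" and "finite E" and "card E = d"
  shows "\<not> elusive E \<gamma> (Pow E - {{}}) u"
proof
  assume el: "elusive E \<gamma> (Pow E - {{}}) u"
  let ?Z = "E <+> A" and ?n = "2 ^ d - 1 :: nat"
  let ?G = "chips A E \<gamma> (Pow E - {{}}) u"
  have \<gamma>: "\<gamma> \<in> E \<rightarrow> A" and u: "u \<in> ?Z \<rightarrow>\<^sub>E A" and u_notin: "u \<notin> Sg ?Z ?G"
    using el by (auto simp: elusive_def)
  obtain t e where "d \<ge> 1" and t: "term_operation A S ar f ?n t"
    and e: "bij_betw e {1..?n} {I. I \<subseteq> {1..d} \<and> I \<noteq> {}}"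
    and cube: "\<And>a b. a \<in> tuples A d \<Longrightarrow> b \<in> tuples A d \<Longrightarrow>
      (\<lambda>i\<in>{1..d}. t (\<lambda>j\<in>{1..?n}. chi d (e j) a b i)) = a"
    using assms(1) unfolding has_cube_term_dim_def cube_term_def by blast
  obtain \<psi> where \<psi>: "bij_betw \<psi> E {1..d}"
    using finite_same_card_bij[OF assms(2), of "{1..d}"] assms(3) by auto
  define \<phi> where "\<phi> = inv_into E \<psi>"
  have \<phi>: "\<phi> i \<in> E" if "i \<in> {1..d}" for i
    using \<psi> that unfolding \<phi>_def by (auto simp: bij_betw_def intro: inv_into_into)
  have \<phi>\<psi>: "\<phi> (\<psi> x) = x" "\<psi> x \<in> {1..d}" if "x \<in> E" for x
    using \<psi> that unfolding \<phi>_def by (auto simp: bij_betw_def)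
  define h where "h j = (\<lambda>z\<in>?Z. u (shift \<gamma> {x\<in>E. \<psi> x \<in> e j} z))" for j
  have "h j \<in> ?G" if "j \<in> {1..?n}" for j
  proof -
    have "e j \<subseteq> {1..d}" "e j \<noteq> {}" using bij_betw_apply[OF e that] by auto
    then obtain i where "i \<in> e j" "i \<in> \<psi> ` E"
      using bij_betw_imp_surj_on[OF \<psi>] by blast
    then have "{x\<in>E. \<psi> x \<in> e j} \<noteq> {}" by blast
    then show ?thesis by (auto simp: h_def chips_def)
  qed
  then have "(\<lambda>z\<in>?Z. t (\<lambda>j\<in>{1..?n}. h j z)) \<in> Sg ?Z ?G"
    by (intro Sg_term_operation[OF t chips_in_PiE[OF \<gamma> u]] generated.gen)
  moreover have "(\<lambda>z\<in>?Z. t (\<lambda>j\<in>{1..?n}. h j z)) = u"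
  proof (rule extensionalityI)
    show "u \<in> extensional ?Z" using u by (simp add: PiE_def)
    fix z assume z: "z \<in> ?Z"
    then consider x where "x \<in> E" "z = Inl x" | c where "c \<in> A" "z = Inr c" by blast
    then show "(\<lambda>z\<in>?Z. t (\<lambda>j\<in>{1..?n}. h j z)) z = u z"
    proof cases
      case 1
      let ?a = "\<lambda>i\<in>{1..d}. u (Inl (\<phi> i))" and ?b = "\<lambda>i\<in>{1..d}. u (Inr (\<gamma> (\<phi> i)))"
      have "?a \<in> tuples A d" "?b \<in> tuples A d"
        unfolding tuples_def restrict_PiE_iff using u \<phi> \<gamma> by (auto simp: PiE_iff Pi_iff)
      from fun_cong[OF cube[OF this], of "\<psi> x"] have
        "t (\<lambda>j\<in>{1..?n}. chi d (e j) ?a ?b (\<psi> x)) = u z"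
        using \<phi>\<psi>[OF 1(1)] 1 by simp
      moreover have "(\<lambda>j\<in>{1..?n}. chi d (e j) ?a ?b (\<psi> x)) = (\<lambda>j\<in>{1..?n}. h j z)"
        using \<phi>\<psi>[OF 1(1)] 1 by (auto simp: chi_def h_def)
      ultimately show ?thesis using z by simp
    next
      case 2
      \<comment> \<open>Chipping leaves the parameters alone, so idempotence of \<open>t\<close>
        suffices here. It is the cube identity for \<open>a = b\<close>, read at index 1, which
        exists as \<open>d \<ge> 1\<close>.\<close>
      let ?a = "\<lambda>i\<in>{1..d}. u z"
      have "?a \<in> tuples A d"
        unfolding tuples_def restrict_PiE_iff using PiE_mem[OF u z] by simp
      from fun_cong[OF cube[OF this this], of 1] have
        "t (\<lambda>j\<in>{1..?n}. chi d (e j) ?a ?a 1) = u z"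
        using \<open>d \<ge> 1\<close> by simp
      moreover have "(\<lambda>j\<in>{1..?n}. chi d (e j) ?a ?a 1) = (\<lambda>j\<in>{1..?n}. h j z)"
        using \<open>d \<ge> 1\<close> z 2 by (auto simp: chi_def h_def)
      ultimately show ?thesis using z by simp
    qed
  qed simp
  ultimately show False using u_notin by simp
qed

text \<open>Only the set of columns is required to be nonempty. If a column has no rows, the empty
  set of rows is included, and \<open>u\<close> is its own chip.\<close>

definition cols :: "'e set \<Rightarrow> ('e \<Rightarrow> nat) \<Rightarrow> nat \<Rightarrow> 'e set set" where
  "cols E col N = (\<lambda>I. {x\<in>E. col x \<in> I}) ` (Pow {1..N} - {{}})"

text \<open>Column \<open>i\<close> has a row for every possible pair \<open>(a i, b i)\<close>,
  with entry \<open>a i\<close> and parameter \<open>b i\<close>. A term operation deriving this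
  tuple from its chips thus satisfies the cube identity for all \<open>a\<close>, \<open>b\<close>
  at once.\<close>

lemma not_cube_term_imp_elusive:
  assumes "\<not> has_cube_term_dim A S ar f N" and "N \<ge> 1"
  defines "E \<equiv> (A \<times> A) \<times> {1..N}"
  shows "elusive E (snd \<circ> fst) (cols E snd N) (\<lambda>z\<in>E <+> A. case z of Inl x \<Rightarrow> fst (fst x) | Inr a \<Rightarrow> a)"
    (is "elusive E ?\<gamma> ?\<I> ?u")
proof -
  let ?Z = "E <+> A" and ?n = "2 ^ N - 1 :: nat"
  have \<gamma>: "?\<gamma> \<in> E \<rightarrow> A" and u: "?u \<in> ?Z \<rightarrow>\<^sub>E A" by (auto simp: E_def)
  have "?u \<notin> Sg ?Z (chips A E ?\<gamma> ?\<I> ?u)"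
  proof
    assume u_in: "?u \<in> Sg ?Z (chips A E ?\<gamma> ?\<I> ?u)"
    have "card (Pow {1..N} - {{}}) = ?n" by (simp add: card_Diff_singleton card_Pow)
    then obtain e where e: "bij_betw e {1..?n} (Pow {1..N} - {{}})"
      using finite_same_card_bij[of "{1..?n}" "Pow {1..N} - {{}}"] by auto
    define h where "h j = (\<lambda>z\<in>?Z. ?u (shift ?\<gamma> {x\<in>E. snd x \<in> e j} z))" for j
    have "chips A E ?\<gamma> ?\<I> ?u = h ` {1..?n}"
      unfolding chips_def cols_def bij_betw_imp_surj_on[OF e, symmetric] image_image h_def ..
    moreover from this have "h j \<in> ?Z \<rightarrow>\<^sub>E A" if "j \<in> {1..?n}" for j
      using chips_in_PiE[OF \<gamma> u, of ?\<I>] that by blast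
    ultimately obtain t where t: "term_operation A S ar f ?n t"
      "\<And>z. z \<in> ?Z \<Longrightarrow> ?u z = t (\<lambda>j\<in>{1..?n}. h j z)"
      using Sg_imp_term_operation[of ?u ?Z h ?n] u_in by metis
    have "(\<lambda>i\<in>{1..N}. t (\<lambda>j\<in>{1..?n}. chi N (e j) a b i)) = a"
      if ab: "a \<in> tuples A N" "b \<in> tuples A N" for a b
    proof (rule extensionalityI)
      show "a \<in> extensional {1..N}" using ab by (simp add: tuples_def PiE_def)
      fix i assume i: "i \<in> {1..N}"
      let ?x = "((a i, b i), i)"
      have x: "?x \<in> E" using i ab by (auto simp: E_def tuples_def)
      then have "(\<lambda>j\<in>{1..?n}. chi N (e j) a b i) = (\<lambda>j\<in>{1..?n}. h j (Inl ?x))"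
        using i by (intro restrict_ext) (auto simp: chi_def h_def E_def)
      then show "(\<lambda>i\<in>{1..N}. t (\<lambda>j\<in>{1..?n}. chi N (e j) a b i)) i = a i"
        using t(2)[of "Inl ?x"] x i by (simp add: InlI)
    qed simp
    moreover have "bij_betw e {1..?n} {I. I \<subseteq> {1..N} \<and> I \<noteq> {}}"
      using e by (simp add: Pow_def set_diff_eq)
    ultimately show False
      using assms(1,2) t(1) unfolding has_cube_term_dim_def cube_term_def by blast
  qed
  then show ?thesis using \<gamma> u by (simp add: elusive_def)
qed

section \<open>Reduction to one row per column\<close>

lemma Sg_restrict_lift:
  assumes "x \<in> Sg Z' ((\<lambda>g. restrict g Z') ` G)" and "Z' \<subseteq> Z"
  shows "\<exists>y\<in>Sg Z G. restrict y Z' = x"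
  using assms(1)
proof induction
  case (gen g)
  then obtain g' where g': "g = restrict g' Z'" "g' \<in> G" by (rule imageE)
  show ?case by (rule bexI[of _ g'], rule g'(1)[symmetric], rule generated.gen[OF g'(2)])
next
  case (app s h)
  have "\<forall>l\<in>{1..ar s}. \<exists>y. y \<in> Sg Z G \<and> restrict y Z' = h l"
    using app.IH unfolding Bex_def by (rule ballI)
  from bchoice[OF this] obtain y where
    y: "\<And>l. l \<in> {1..ar s} \<Longrightarrow> y l \<in> Sg Z G \<and> restrict (y l) Z' = h l" by fast
  have "(\<lambda>i\<in>Z. f s (\<lambda>l\<in>{1..ar s}. y l i)) \<in> Sg Z G"
    using app.hyps(1) y by (intro generated.app) blast+
  moreover have "(\<lambda>l\<in>{1..ar s}. y l i) = (\<lambda>l\<in>{1..ar s}. h l i)" if "i \<in> Z'" for i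
    using y that by (intro restrict_ext) (metis restrict_apply')
  then have "restrict (\<lambda>i\<in>Z. f s (\<lambda>l\<in>{1..ar s}. y l i)) Z' = (\<lambda>i\<in>Z'. f s (\<lambda>l\<in>{1..ar s}. h l i))"
    using assms(2) by (intro ext) (simp add: subset_iff)
  ultimately show ?case by blast
qed


text \<open>
  The elusive tuple above has \<open>|A|\<^sup>2\<close> rows in each column. Two rows in one column are too many: if
  dropping row \<open>e\<close> destroys elusiveness, then changing the entry of row \<open>e\<close> alone leads into the
  subalgebra, and row \<open>e\<close> with the changed entry as its new parameter can replace the whole column.
\<close>

lemma elusive_imp_inj_on_cols:
  assumes "finite E" and "elusive E \<gamma> (cols E col N) u" and "\<And>a. a \<in> A \<Longrightarrow> u (Inr a) = a"
  shows "\<exists>E'\<subseteq>E. inj_on col E' \<and> (\<exists>\<gamma>' u'. elusive E' \<gamma>' (cols E' col N) u')"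
  using assms
proof (induction "card E" arbitrary: E \<gamma> u rule: less_induct)
  case less
  show ?case
  proof (cases "inj_on col E")
    case True
    then show ?thesis using less.prems by blast
  next
    case False
    then obtain e e1 where e: "e \<in> E" "e1 \<in> E" "e \<noteq> e1" "col e = col e1"
      by (auto simp: inj_on_def)
    let ?Z = "E <+> A" and ?R = "Sg (E <+> A) (chips A E \<gamma> (cols E col N) u)"
    have \<gamma>: "\<gamma> \<in> E \<rightarrow> A" and u: "u \<in> ?Z \<rightarrow>\<^sub>E A" and u_notin: "u \<notin> ?R"
      using less.prems(2) by (auto simp: elusive_def)
    have R_in: "?R \<subseteq> ?Z \<rightarrow>\<^sub>E A" by (intro Sg_in_PiE chips_in_PiE \<gamma> u)
    have u_Inr: "u (Inr a) = a" if "a \<in> A" for a using less.prems(3) that .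
    have u_Inl: "u (Inl x) \<in> A" if "x \<in> E" for x using u that by (auto simp: PiE_iff)
    define E1 where "E1 = E - {e}"
    define u1 where "u1 = restrict u (E1 <+> A)"
    have u1: "u1 \<in> (E1 <+> A) \<rightarrow>\<^sub>E A" "\<gamma> \<in> E1 \<rightarrow> A"
      using u \<gamma> by (auto simp: u1_def E1_def PiE_iff Pi_iff)
    show ?thesis
    proof (cases "elusive E1 \<gamma> (cols E1 col N) u1")
      case True
      have "card E1 < card E" "finite E1"
        using e(1) less.prems(1) card_Diff1_less[of E e] by (auto simp: E1_def)
      moreover have "u1 (Inr a) = a" if "a \<in> A" for a using that u_Inr by (simp add: u1_def InrI)
      ultimately have "\<exists>E'\<subseteq>E1. inj_on col E' \<and> (\<exists>\<gamma>' u'. elusive E' \<gamma>' (cols E' col N) u')"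
        using True by (intro less.hyps[of E1 \<gamma> u1])
      then show ?thesis unfolding E1_def by blast
    next
      case False
      then have "u1 \<in> Sg (E1 <+> A) (chips A E1 \<gamma> (cols E1 col N) u1)"
        using u1 by (simp add: elusive_def)
      also have "chips A E1 \<gamma> (cols E1 col N) u1 =
          (\<lambda>g. restrict g (E1 <+> A)) ` chips A E \<gamma> (cols E col N) u"
        unfolding chips_def cols_def image_image
      proof (intro image_cong refl restrict_ext)
        fix I z assume z: "z \<in> E1 <+> A"
        have "shift \<gamma> {x\<in>E1. col x \<in> I} z = shift \<gamma> {x\<in>E. col x \<in> I} z"
          using z by (cases z) (simp_all add: E1_def)
        moreover have "shift \<gamma> {x\<in>E1. col x \<in> I} z \<in> E1 <+> A"
          using z shift_in_Plus[OF u1(2)] by blast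
        moreover have "z \<in> ?Z" using z by (auto simp: E1_def)
        ultimately show "u1 (shift \<gamma> {x\<in>E1. col x \<in> I} z) =
            (\<lambda>z\<in>?Z. u (shift \<gamma> {x\<in>E. col x \<in> I} z)) z"
          by (simp add: u1_def)
      qed
      \<comment> \<open>Repeating the derivation of \<open>u1\<close> on full tuples gives
        \<open>y\<close>, which agrees with \<open>u\<close> except possibly at row
        \<open>e\<close>.\<close>
      finally obtain y where y: "y \<in> ?R" "restrict y (E1 <+> A) = u1"
        using Sg_restrict_lift[of u1 "E1 <+> A" _ ?Z] by (auto simp: E1_def)
      have y_eq: "y z = u z" if "z \<in> E1 <+> A" for z
        using fun_cong[OF y(2), of z] that by (simp add: u1_def)
      have y_PiE: "y \<in> ?Z \<rightarrow>\<^sub>E A" using y(1) R_in by blast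
      then have y_e: "y (Inl e) \<in> A" using e(1) by (auto simp: PiE_iff)
      \<comment> \<open>Row \<open>e\<close> becomes the only row of its column. With this
        parameter, chipping it puts the entry of \<open>y\<close> there.\<close>
      define E2 where "E2 = {x\<in>E. col x = col e \<longrightarrow> x = e}"
      define \<gamma>2 where "\<gamma>2 = \<gamma>(e := y (Inl e))"
      define u2 where "u2 = restrict u (E2 <+> A)"
      have E2: "E2 \<subseteq> E" "e1 \<notin> E2" "e \<in> E2" using e by (auto simp: E2_def)
      have u2: "u2 \<in> (E2 <+> A) \<rightarrow>\<^sub>E A" "\<gamma>2 \<in> E2 \<rightarrow> A"
        using u \<gamma> E2 y_e by (auto simp: u2_def \<gamma>2_def PiE_iff Pi_iff)
      \<comment> \<open>A dropped row is recovered from the parameter that equals its entry, since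
        \<open>u\<close> is the identity on parameters.\<close>
      define \<rho> where "\<rho> z = (case z of Inl x \<Rightarrow> if x \<in> E2 then Inl x else Inr (u (Inl x)) | Inr a \<Rightarrow> Inr a)"
        for z :: "'b + 'a"
      have \<rho>_simps [simp]: "\<rho> (Inl x) = (if x \<in> E2 then Inl x else Inr (u (Inl x)))" "\<rho> (Inr a) = Inr a" for x a
        by (simp_all add: \<rho>_def)
      have "u2 \<notin> Sg (E2 <+> A) (chips A E2 \<gamma>2 (cols E2 col N) u2)"
      proof
        assume "u2 \<in> Sg (E2 <+> A) (chips A E2 \<gamma>2 (cols E2 col N) u2)"
        then have "(\<lambda>z\<in>?Z. u2 (\<rho> z)) \<in> ?R"
        proof (rule generated_reindex)
          show "\<rho> \<in> ?Z \<rightarrow> E2 <+> A" using u_Inl by auto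
          fix g assume "g \<in> chips A E2 \<gamma>2 (cols E2 col N) u2"
          then obtain I where I: "I \<subseteq> {1..N}" "I \<noteq> {}"
            and g: "g = (\<lambda>z\<in>E2 <+> A. u2 (shift \<gamma>2 {x\<in>E2. col x \<in> I} z))"
            by (auto simp: chips_def cols_def)
          have g_Inr: "g (Inr a) = a" if "a \<in> A" for a
            using that u_Inr by (simp add: g u2_def InrI)
          have g_Inl: "g (Inl x) = (if col x \<in> I then \<gamma>2 x else u (Inl x))" if "x \<in> E2" for x
            using that u_Inr u2(2) E2(1) by (auto simp: g u2_def Pi_iff InlI InrI)
          have chip: "(\<lambda>z\<in>?Z. u (shift \<gamma> {x\<in>E. col x \<in> J} z)) \<in> ?R" if "J \<subseteq> {1..N}" "J \<noteq> {}" for J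
            using that by (intro generated.gen) (auto simp: chips_def cols_def)
          \<comment> \<open>If the column of \<open>e\<close> is not chipped, this is a chip of
            \<open>u\<close>. Otherwise it is \<open>y\<close> chipped at the other columns of
            \<open>I\<close>, or \<open>y\<close> itself if there are none.\<close>
          show "(\<lambda>z\<in>?Z. g (\<rho> z)) \<in> ?R"
          proof (cases "col e \<in> I")
            case False
            have "(\<lambda>z\<in>?Z. g (\<rho> z)) = (\<lambda>z\<in>?Z. u (shift \<gamma> {x\<in>E. col x \<in> I} z))"
            proof (rule restrict_ext)
              fix z assume "z \<in> ?Z"
              then consider x where "z = Inl x" "x \<in> E" | a where "z = Inr a" "a \<in> A" by blast
              then show "g (\<rho> z) = u (shift \<gamma> {x\<in>E. col x \<in> I} z)"
              proof cases
                case 1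
                show ?thesis
                proof (cases "x \<in> E2")
                  case True
                  then show ?thesis using 1 False g_Inl \<gamma> u_Inr by (auto simp: \<gamma>2_def Pi_iff)
                next
                  case x: False
                  then have "col x = col e" using 1 by (auto simp: E2_def)
                  then show ?thesis using x 1 False g_Inr u_Inl by auto
                qed
              qed (simp add: g_Inr u_Inr)
            qed
            then show ?thesis using chip[OF I] by simp
          next
            case True
            have eq: "(\<lambda>z\<in>?Z. g (\<rho> z)) = (\<lambda>z\<in>?Z. y (shift \<gamma> {x\<in>E. col x \<in> I - {col e}} z))"
            proof (rule restrict_ext)
              fix z assume "z \<in> ?Z"
              then consider x where "z = Inl x" "x \<in> E" | a where "z = Inr a" "a \<in> A" by blast
              then show "g (\<rho> z) = y (shift \<gamma> {x\<in>E. col x \<in> I - {col e}} z)"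
              proof cases
                case 1
                then consider "x = e" | "x \<in> E1" "x \<in> E2" "col x \<noteq> col e" | "x \<in> E1" "x \<notin> E2" "col x = col e"
                  by (auto simp: E1_def E2_def)
                then show ?thesis
                proof cases
                  case 1
                  then show ?thesis using True g_Inl E2(3) \<open>z = Inl x\<close> by (simp add: \<gamma>2_def)
                next
                  case 2
                  then have "x \<noteq> e" by auto
                  then show ?thesis
                    using 2 \<open>z = Inl x\<close> \<open>x \<in> E\<close> g_Inl \<gamma> u_Inr y_eq
                    by (auto simp: \<gamma>2_def Pi_iff InlI InrI)
                next
                  case 3
                  then show ?thesis
                    using \<open>z = Inl x\<close> \<open>x \<in> E\<close> g_Inr u_Inl y_eq by (auto simp: InlI)
                qed
              qed (simp add: g_Inr u_Inr y_eq InrI)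
            qed
            show ?thesis
            proof (cases "I = {col e}")
              case True
              have "(\<lambda>z\<in>?Z. g (\<rho> z)) = y"
                unfolding eq
              proof (rule extensionalityI)
                show "y \<in> extensional ?Z" using y_PiE by (simp add: PiE_iff)
                fix z assume "z \<in> ?Z"
                then show "(\<lambda>z\<in>?Z. y (shift \<gamma> {x\<in>E. col x \<in> I - {col e}} z)) z = y z"
                  using True by (cases z) auto
              qed simp
              then show ?thesis using y(1) by simp
            next
              case False
              have "{x\<in>E. col x \<in> I - {col e}} \<union> J \<in> cols E col N" if "J \<in> cols E col N" for J
              proof -
                obtain I' where I': "J = {x\<in>E. col x \<in> I'}" "I' \<subseteq> {1..N}" "I' \<noteq> {}"
                  using \<open>J \<in> cols E col N\<close> by (auto simp: cols_def)
                have "{x\<in>E. col x \<in> I - {col e}} \<union> J = {x\<in>E. col x \<in> (I - {col e}) \<union> I'}"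
                  using I'(1) by auto
                moreover have "(I - {col e}) \<union> I' \<in> Pow {1..N} - {{}}" using I I' by auto
                ultimately show ?thesis unfolding cols_def by blast
              qed
              then show ?thesis unfolding eq using y(1) \<gamma> by (intro chips_closed)
            qed
          qed
        qed
        also have "(\<lambda>z\<in>?Z. u2 (\<rho> z)) = u"
        proof (rule extensionalityI)
          show "u \<in> extensional ?Z" using u by (simp add: PiE_iff)
          fix z assume "z \<in> ?Z"
          then show "(\<lambda>z\<in>?Z. u2 (\<rho> z)) z = u z"
            using u_Inl u_Inr by (cases z) (simp_all add: u2_def)
        qed simp
        finally show False using u_notin by simp
      qed
      then have "elusive E2 \<gamma>2 (cols E2 col N) u2" using u2 by (simp add: elusive_def)
      moreover have "card E2 < card E" "finite E2"
        using E2 e(2) less.prems(1) by (auto intro: psubset_card_mono finite_subset)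
      moreover have "u2 (Inr a) = a" if "a \<in> A" for a using that u_Inr by (simp add: u2_def InrI)
      ultimately have "\<exists>E'\<subseteq>E2. inj_on col E' \<and> (\<exists>\<gamma>' u'. elusive E' \<gamma>' (cols E' col N) u')"
        by (intro less.hyps[of E2 \<gamma>2 u2])
      then show ?thesis using E2(1) by blast
    qed
  qed
qed


subsection \<open>Adding a row\<close>

text \<open>Otherwise chipping row \<open>j\<close> alone gives back \<open>u\<close>, which is then
  a generator.\<close>

lemma elusive_imp_ne:
  assumes "elusive E \<gamma> (Pow E - {{}}) u" and "j \<in> E"
  shows "u (Inl j) \<noteq> u (Inr (\<gamma> j))"
proof
  assume eq: "u (Inl j) = u (Inr (\<gamma> j))"
  have "(\<lambda>z\<in>E <+> A. u (shift \<gamma> {j} z)) = u"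
  proof (rule extensionalityI)
    show "u \<in> extensional (E <+> A)" using assms(1) by (simp add: elusive_def PiE_iff)
    show "(\<lambda>z\<in>E <+> A. u (shift \<gamma> {j} z)) z = u z" if "z \<in> E <+> A" for z
      using eq that by (cases z) auto
  qed simp
  moreover have "(\<lambda>z\<in>E <+> A. u (shift \<gamma> {j} z)) \<in> chips A E \<gamma> (Pow E - {{}}) u"
    using assms(2) by (auto simp: chips_def)
  ultimately show False
    using assms(1) generated.gen[of u "chips A E \<gamma> (Pow E - {{}}) u" S ar f] by (simp add: elusive_def)
qed

lemma elusive_add_row:
  fixes E :: "'e set"
  assumes fin: "finite A" "finite E" and "elusive E \<gamma> (Pow E - {{}}) u"
    and ar: "\<And>s. s \<in> S \<Longrightarrow> ar s \<le> m" and "m \<ge> 1" and card_E: "card E \<ge> card A ^ 3 * m"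
  shows "\<exists>E' :: 'e option set. \<exists>\<gamma>' u'.
    finite E' \<and> card E' = Suc (card E) \<and> elusive E' \<gamma>' (Pow E' - {{}}) u'"
proof -
  let ?Z = "E <+> A"
  let ?el = "\<lambda>v. elusive E \<gamma> (Pow E - {{}}) v"
  define R where "R v = Sg ?Z (chips A E \<gamma> (Pow E - {{}}) v)" for v
  \<comment> \<open>The given \<open>u\<close> is replaced by a minimal one for the same
    \<open>E\<close> and \<open>\<gamma>\<close>; the tuple \<open>v\<close> below competes with
    it.\<close>
  obtain u where u_el: "?el u" and u_min: "\<And>v. ?el v \<Longrightarrow> card (R u) \<le> card (R v)"
    using ex_has_least_nat[of ?el u "\<lambda>v. card (R v)"] assms(3) by auto
  have \<gamma>: "\<gamma> \<in> E \<rightarrow> A" and u: "u \<in> ?Z \<rightarrow>\<^sub>E A" and u_notin: "u \<notin> R u"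
    using u_el by (auto simp: elusive_def R_def)
  have R_in: "R u \<subseteq> ?Z \<rightarrow>\<^sub>E A" unfolding R_def by (intro Sg_in_PiE chips_in_PiE \<gamma> u)
  have fin_R: "finite (R u)" using fin by (intro finite_subset[OF R_in] finite_PiE) auto
  have "A \<noteq> {}" using is_algebra by (simp add: is_algebra_def)
  \<comment> \<open>There are |A|^2 pairs of an entry and a parameter, so one of them is shared by
    at least |A|m rows.\<close>
  define cl where "cl j = (u (Inl j), \<gamma> j)" for j
  obtain p where p: "card (cl -` {p} \<inter> E) * card (A \<times> A) \<ge> card E"
    using pigeonhole_card[of cl E "A \<times> A"] \<gamma> u fin \<open>A \<noteq> {}\<close>
    by (auto simp: cl_def PiE_iff Pi_iff)
  define J where "J = cl -` {p} \<inter> E"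
  have "card A > 0" using fin(1) \<open>A \<noteq> {}\<close> by (simp add: card_gt_0_iff)
  have "(card A * m) * card (A \<times> A) = card A ^ 3 * m"
    by (simp add: card_cartesian_product power3_eq_cube)
  also have "\<dots> \<le> card J * card (A \<times> A)" using p card_E unfolding J_def by (rule order_trans[rotated])
  finally have card_J: "card A * m \<le> card J"
    using \<open>card A > 0\<close> by (simp add: card_cartesian_product)
  moreover have "card A * m > 0" using \<open>card A > 0\<close> \<open>m \<ge> 1\<close> by simp
  ultimately obtain j0 where j0: "j0 \<in> J" by (metis card.empty ex_in_conv not_less)
  have J: "J \<subseteq> E" "\<And>j. j \<in> J \<Longrightarrow> u (Inl j) = u (Inl j0) \<and> \<gamma> j = \<gamma> j0"
    using j0 by (auto simp: J_def cl_def)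

  \<comment> \<open>\<open>None\<close> is the duplicate of row \<open>j0\<close>. It makes the
    class \<open>J'\<close> strictly larger than |A|m, as the count of bad rows requires.\<close>
  define E' where "E' = insert None (Some ` E)"
  define J' where "J' = insert None (Some ` J)"
  define \<gamma>' where "\<gamma>' = case_option (\<gamma> j0) \<gamma>"
  define u' where "u' = (\<lambda>z\<in>E' <+> A. u (map_sum (case_option j0 id) id z))"
  let ?Z' = "E' <+> A"
  define R' where "R' = Sg ?Z' (chips A E' \<gamma>' (Pow E' - {{}}) u')"
  have E': "finite E'" "card E' = Suc (card E)"
    using fin(2) by (auto simp: E'_def card_image)
  have J': "J' \<subseteq> E'" using J(1) by (auto simp: J'_def E'_def)
  have "finite J" using J(1) fin(2) finite_subset by blast
  then have card_J': "finite J'" "card J' > card A * m"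
    using card_J by (auto simp: J'_def card_image)
  have \<gamma>': "\<gamma>' \<in> E' \<rightarrow> A" using \<gamma> j0 J(1) by (auto simp: E'_def \<gamma>'_def)
  have u'_Inl: "u' (Inl i) = u (Inl (case_option j0 id i))" if "i \<in> E'" for i
    using that by (simp add: u'_def)
  have u'_Inr: "u' (Inr a) = u (Inr a)" if "a \<in> A" for a
    using that by (simp add: u'_def)
  have u': "u' \<in> ?Z' \<rightarrow>\<^sub>E A"
    using u j0 J(1) by (auto simp: u'_def E'_def PiE_iff)
  have same_class: "u' (Inl i) = u (Inl j0)" "\<gamma>' i = \<gamma> j0" if "i \<in> J'" for i
    using that J J' by (auto simp: J'_def u'_Inl subset_iff \<gamma>'_def)

  \<comment> \<open>A good \<open>\<sigma>\<close> embeds \<open>E\<close> into \<open>E'\<close>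
    and so omits exactly one row; \<open>sel \<sigma> x\<close> is \<open>x\<close> without it. All
    such embeddings are considered, since rows of the class get exchanged below.\<close>
  define good where "good \<sigma> \<longleftrightarrow> inj_on \<sigma> E \<and>
    (\<forall>j\<in>E. \<sigma> j \<in> E' \<and> u' (Inl (\<sigma> j)) = u (Inl j) \<and> \<gamma>' (\<sigma> j) = \<gamma> j)" for \<sigma>
  define sel where "sel \<sigma> x = (\<lambda>z\<in>?Z. x (map_sum \<sigma> id z))" for \<sigma> :: "'e \<Rightarrow> 'e option" and x :: "'e option + 'a \<Rightarrow> 'a"
  have sel_in: "map_sum \<sigma> id z \<in> ?Z'" if "good \<sigma>" "z \<in> ?Z" for \<sigma> z
    using that by (cases z) (auto simp: good_def)
  have chip_gen: "(\<lambda>z\<in>?Z. u (shift \<gamma> I z)) \<in> R u" if "I \<subseteq> E" "I \<noteq> {}" for I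
    unfolding R_def chips_def using that by (intro generated.gen) auto
  have sel_chip: "sel \<sigma> (\<lambda>z\<in>?Z'. u' (shift \<gamma>' I z)) = (\<lambda>z\<in>?Z. u (shift \<gamma> {j\<in>E. \<sigma> j \<in> I} z))"
    if "good \<sigma>" for \<sigma> I
    unfolding sel_def
  proof (rule restrict_ext)
    fix z assume z: "z \<in> ?Z"
    then show "(\<lambda>z\<in>?Z'. u' (shift \<gamma>' I z)) (map_sum \<sigma> id z) = u (shift \<gamma> {j\<in>E. \<sigma> j \<in> I} z)"
      using sel_in[OF that z] that \<gamma> by (cases z) (auto simp: good_def u'_Inr Pi_iff)
  qed
  \<comment> \<open>Selecting alone can turn a chip of \<open>u'\<close> into \<open>u\<close>,
    namely when only the omitted row is chipped. Chipping further at a nonempty \<open>I\<close>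
    rules this out.\<close>
  have chip_sel: "(\<lambda>z\<in>?Z. sel \<sigma> x (shift \<gamma> I z)) \<in> R u"
    if x: "x \<in> R'" and \<sigma>: "good \<sigma>" and I: "I \<subseteq> E" "I \<noteq> {}" for \<sigma> x I
  proof -
    have shift_in: "shift \<gamma> I z \<in> ?Z" if "z \<in> ?Z" for z
      using shift_in_Plus[OF \<gamma>, of I] that by blast
    have "(\<lambda>z\<in>?Z. x (map_sum \<sigma> id (shift \<gamma> I z))) \<in> R u"
      using x unfolding R'_def R_def
    proof (rule generated_reindex)
      show "(\<lambda>z. map_sum \<sigma> id (shift \<gamma> I z)) \<in> ?Z \<rightarrow> ?Z'" using shift_in sel_in[OF \<sigma>] by blast
      fix g assume "g \<in> chips A E' \<gamma>' (Pow E' - {{}}) u'"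
      then obtain I' where g: "g = (\<lambda>z\<in>?Z'. u' (shift \<gamma>' I' z))" by (auto simp: chips_def)
      have "(\<lambda>z\<in>?Z. g (map_sum \<sigma> id (shift \<gamma> I z))) = (\<lambda>z\<in>?Z. sel \<sigma> g (shift \<gamma> I z))"
        using shift_in by (intro restrict_ext) (simp add: sel_def)
      also have "\<dots> = (\<lambda>z\<in>?Z. u (shift \<gamma> (I \<union> {j\<in>E. \<sigma> j \<in> I'}) z))"
        unfolding g sel_chip[OF \<sigma>] using shift_in by (intro restrict_ext) (simp add: shift_shift)
      also have "\<dots> \<in> R u" using I by (intro chip_gen) auto
      finally show "(\<lambda>z\<in>?Z. g (map_sum \<sigma> id (shift \<gamma> I z))) \<in> Sg ?Z (chips A E \<gamma> (Pow E - {{}}) u)"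
        unfolding R_def .
    qed
    also have "(\<lambda>z\<in>?Z. x (map_sum \<sigma> id (shift \<gamma> I z))) = (\<lambda>z\<in>?Z. sel \<sigma> x (shift \<gamma> I z))"
      using shift_in by (intro restrict_ext) (simp add: sel_def)
    finally show ?thesis .
  qed
  have missing: "\<sigma> ` E = E' - {i}" if "good \<sigma>" "i \<in> J'" "i \<notin> \<sigma> ` E" for \<sigma> i
  proof (rule card_subset_eq)
    show "finite (E' - {i})" using E' by simp
    show "\<sigma> ` E \<subseteq> E' - {i}" using that by (auto simp: good_def)
    show "card (\<sigma> ` E) = card (E' - {i})"
      using that E' J' by (auto simp: good_def card_image)
  qed

  have R'_in: "R' \<subseteq> ?Z' \<rightarrow>\<^sub>E A" unfolding R'_def by (intro Sg_in_PiE chips_in_PiE \<gamma>' u')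
  \<comment> \<open>Applied to \<open>u'\<close>, where \<open>None\<close> and
    \<open>Some j0\<close> agree, this will put \<open>u\<close> into \<open>R u\<close>. Stated for
    all of \<open>R'\<close>, it can be proved along a derivation.\<close>
  have main: "sel \<sigma> x \<in> R u"
    if "x \<in> R'" "good \<sigma>" "i \<in> J'" "i' \<in> J'" "i \<noteq> i'" "i \<notin> \<sigma> ` E" "x (Inl i) = x (Inl i')" for \<sigma> x i i'
    using that unfolding R'_def
  proof (induction arbitrary: \<sigma> i i')
    case (gen g)
    then obtain I where I: "I \<subseteq> E'" "I \<noteq> {}" and g: "g = (\<lambda>z\<in>?Z'. u' (shift \<gamma>' I z))"
      by (auto simp: chips_def)
    \<comment> \<open>Otherwise only the omitted row \<open>i\<close> is chipped. It then carries
      the entry of its parameter while \<open>i'\<close> keeps that of \<open>u\<close>, and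
      \<open>elusive_imp_ne\<close> separates the two.\<close>
    have "{j\<in>E. \<sigma> j \<in> I} \<noteq> {}"
    proof
      assume "{j\<in>E. \<sigma> j \<in> I} = {}"
      then have "I \<inter> \<sigma> ` E = {}" by auto
      then have I_eq: "I = {i}" using I unfolding missing[OF gen.prems(1,2,5)] by auto
      have "i \<in> E'" "i' \<in> E'" using gen.prems(2,3) J' by auto
      then have "u' (Inr (\<gamma>' i)) = u' (Inl i')"
        using gen.prems(4,6) unfolding g I_eq by simp
      moreover have "\<gamma> j0 \<in> A" using \<gamma> j0 J(1) by auto
      ultimately have "u (Inr (\<gamma> j0)) = u (Inl j0)"
        by (simp add: same_class(1)[OF gen.prems(3)] same_class(2)[OF gen.prems(2)] u'_Inr)
      then show False using elusive_imp_ne[OF u_el, of j0] j0 J(1) by auto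
    qed
    then show ?case unfolding g sel_chip[OF gen.prems(1)] by (intro chip_gen) auto
  next
    case (app s h)
    define x where "x = (\<lambda>z\<in>?Z'. f s (\<lambda>l\<in>{1..ar s}. h l z))"
    have x_R': "x \<in> R'" unfolding x_def R'_def using app.hyps by (intro generated.app)
    have sel_x: "sel \<tau> x = (\<lambda>z\<in>?Z. f s (\<lambda>l\<in>{1..ar s}. sel \<tau> (h l) z))" if "good \<tau>" for \<tau>
      unfolding sel_def x_def using sel_in[OF that] by (intro restrict_ext) (auto cong: restrict_cong)
    define Bad where "Bad = {k\<in>J'. \<exists>\<tau>. good \<tau> \<and> k \<notin> \<tau> ` E \<and> sel \<tau> x \<notin> R u}"
    have BadI: "k \<in> Bad" if "k \<in> J'" "good \<tau>" "k \<notin> \<tau> ` E" "sel \<tau> x \<notin> R u" for k \<tau>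
      unfolding Bad_def using that by blast
    \<comment> \<open>If omitting \<open>k\<close> leads out of \<open>R u\<close> for
      \<open>x\<close>, it does so for some argument \<open>h l\<close>. By the induction
      hypothesis, no other row of \<open>J'\<close> has the entry of \<open>k\<close> in
      \<open>h l\<close>.\<close>
    have "\<forall>k\<in>Bad. \<exists>l. l \<in> {1..ar s} \<and> (\<forall>k'\<in>J'. k' \<noteq> k \<longrightarrow> h l (Inl k') \<noteq> h l (Inl k))"
    proof
      fix k assume k: "k \<in> Bad"
      obtain \<tau> where \<tau>: "k \<in> J'" "good \<tau>" "k \<notin> \<tau> ` E" "sel \<tau> x \<notin> R u"
        using k by (auto simp: Bad_def)
      have "\<exists>l\<in>{1..ar s}. sel \<tau> (h l) \<notin> R u"
      proof (rule ccontr)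
        assume "\<not> ?thesis"
        then have "sel \<tau> x \<in> R u"
          unfolding sel_x[OF \<tau>(2)] R_def using app.hyps(1) by (intro generated.app) auto
        then show False using \<tau>(4) by simp
      qed
      then obtain l where l: "l \<in> {1..ar s}" "sel \<tau> (h l) \<notin> R u" by blast
      then have "h l (Inl k') \<noteq> h l (Inl k)" if "k' \<in> J'" "k' \<noteq> k" for k'
        using app.IH[OF l(1) \<tau>(2) \<tau>(1), of k'] \<tau>(3) that by metis
      then show "\<exists>l. l \<in> {1..ar s} \<and> (\<forall>k'\<in>J'. k' \<noteq> k \<longrightarrow> h l (Inl k') \<noteq> h l (Inl k))"
        using l(1) by blast
    qed
    from bchoice[OF this] obtain L where
      L0: "\<forall>k\<in>Bad. L k \<in> {1..ar s} \<and> (\<forall>k'\<in>J'. k' \<noteq> k \<longrightarrow> h (L k) (Inl k') \<noteq> h (L k) (Inl k))" ..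
    have L: "L k \<in> {1..ar s}"
      "k' \<in> J' \<Longrightarrow> k' \<noteq> k \<Longrightarrow> h (L k) (Inl k') \<noteq> h (L k) (Inl k)" if "k \<in> Bad" for k k'
      using bspec[OF L0 that] by simp_all
    have Bad_J': "Bad \<subseteq> J'" by (auto simp: Bad_def)
    \<comment> \<open>The argument index and the private entry determine the bad row, so there are
      at most |A|m bad rows, fewer than rows in \<open>J'\<close>.\<close>
    have "inj_on (\<lambda>k. (L k, h (L k) (Inl k))) Bad"
      using L(2) Bad_J' by (intro inj_onI) (metis snd_conv fst_conv subsetD)
    moreover have "h (L k) (Inl k) \<in> A" if "k \<in> Bad" for k
    proof -
      have "h (L k) \<in> ?Z' \<rightarrow>\<^sub>E A" using app.hyps(2)[OF L(1)[OF that]] R'_in by (auto simp: R'_def)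
      then show ?thesis using that Bad_J' J' by (auto simp: PiE_iff)
    qed
    then have "(\<lambda>k. (L k, h (L k) (Inl k))) ` Bad \<subseteq> {1..ar s} \<times> A" using L(1) by auto
    ultimately have "card Bad \<le> card ({1..ar s} \<times> A)"
      using fin(1) by (intro card_inj_on_le) auto
    also have "\<dots> \<le> card A * m" using ar[OF app.hyps(1)] by (simp add: card_cartesian_product)
    also have "\<dots> < card J'" by (rule card_J')
    finally have "\<not> J' \<subseteq> Bad"
      using card_mono[of Bad J'] finite_subset[OF Bad_J' card_J'(1)] by auto
    then obtain k where k: "k \<in> J'" "k \<notin> Bad" by blast
    show ?case unfolding x_def[symmetric]
    proof (rule ccontr)
      assume notin: "sel \<sigma> x \<notin> R u"
      note \<sigma> = app.prems(1) and ii = app.prems(2-5)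
      have xi: "x (Inl i) = x (Inl i')" using app.prems(6) unfolding x_def .
      have im: "\<sigma> ` E = E' - {i}" by (rule missing[OF \<sigma> ii(1,4)])
      have "i \<in> Bad" using ii(1) \<sigma> ii(4) notin by (rule BadI)
      obtain r' where r': "r' \<in> E" "\<sigma> r' = i'" using im ii J' by (metis DiffI imageE singletonD subsetD)
      have class_E: "u (Inl j) = u (Inl j0)" "\<gamma> j = \<gamma> j0" if "j \<in> E" "\<sigma> j \<in> J'" for j
        using \<sigma> that same_class[OF that(2)] by (auto simp: good_def)
      have upd: "good (\<sigma>(j := i))" if "j \<in> E" "\<sigma> j \<in> J'" for j
        unfolding good_def
      proof (intro conjI ballI)
        show "inj_on (\<sigma>(j := i)) E"
          using \<sigma> ii(4) by (auto simp: good_def intro!: inj_on_fun_updI)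
        fix j' assume "j' \<in> E"
        then show "(\<sigma>(j := i)) j' \<in> E'" "u' (Inl ((\<sigma>(j := i)) j')) = u (Inl j')" "\<gamma>' ((\<sigma>(j := i)) j') = \<gamma> j'"
          using \<sigma> that ii(1) J' same_class[OF ii(1)] class_E[OF that] by (auto simp: good_def)
      qed
      have "i' \<in> Bad"
      proof -
        \<comment> \<open>As \<open>x\<close> agrees at \<open>i\<close> and \<open>i'\<close>,
          omitting \<open>i'\<close> in place of \<open>i\<close> gives the same tuple. Hence both
          are bad and \<open>k\<close> is a third row.\<close>
        have "sel (\<sigma>(r' := i)) x = sel \<sigma> x"
          unfolding sel_def
        proof (rule restrict_ext)
          fix z assume "z \<in> ?Z"
          then show "x (map_sum (\<sigma>(r' := i)) id z) = x (map_sum \<sigma> id z)"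
            using xi r'(2) by (cases z) auto
        qed
        moreover have "i' \<notin> (\<sigma>(r' := i)) ` E"
          using \<sigma> r' ii(3) by (auto simp: good_def inj_on_def)
        ultimately show ?thesis
          using upd[OF r'(1)] r'(2) ii(2) notin by (intro BadI[of _ "\<sigma>(r' := i)"]) simp_all
      qed
      obtain r where r: "r \<in> E" "\<sigma> r = k"
        using im k J' \<open>i \<in> Bad\<close> by (metis DiffI imageE singletonD subsetD)
      have "r \<noteq> r'" using r(2) r'(2) k(2) \<open>i' \<in> Bad\<close> by auto
      have same: "u (Inl r) = u (Inl r')" "\<gamma> r = \<gamma> r'"
        using class_E[of r] class_E[of r'] r r' k(1) ii(2) by auto
      \<comment> \<open>The chips of \<open>v\<close> lie in \<open>R u\<close> but \<open>v\<close>
        does not, so \<open>v\<close> is elusive and minimality forces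
        \<open>R v = R u\<close>.\<close>
      define v where "v = sel \<sigma> x"
      have v: "v \<in> ?Z \<rightarrow>\<^sub>E A"
      proof -
        have "x (map_sum \<sigma> id z) \<in> A" if "z \<in> ?Z" for z
          using subsetD[OF R'_in x_R'] sel_in[OF \<sigma> that] by (rule PiE_mem)
        then show ?thesis unfolding v_def sel_def restrict_PiE_iff by blast
      qed
      have chip_v: "(\<lambda>z\<in>?Z. v (shift \<gamma> I z)) \<in> R u" if "I \<subseteq> E" "I \<noteq> {}" for I
        unfolding v_def using x_R' \<sigma> that by (rule chip_sel)
      have "chips A E \<gamma> (Pow E - {{}}) v \<subseteq> R u" using chip_v by (auto simp: chips_def)
      then have sub: "R v \<subseteq> R u" unfolding R_def by (rule generated_subset)
      then have "?el v" using v \<gamma> notin unfolding elusive_def R_def[symmetric] v_def by blast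
      then have "R v = R u" using sub u_min fin_R by (intro card_subset_eq) (auto intro: le_antisym card_mono)
      then have "(\<lambda>z\<in>?Z. u (shift \<gamma> {r} z)) \<in> Sg ?Z (chips A E \<gamma> (Pow E - {{}}) v)"
        using chip_gen[of "{r}"] r(1) unfolding R_def by simp
      \<comment> \<open>Copying row \<open>r'\<close> onto row \<open>r\<close> turns
        \<open>u\<close> chipped at \<open>r\<close> into \<open>u\<close>, since both rows have the
        same entry in \<open>u\<close>. It remains to see that the chips of \<open>v\<close> are
        mapped into \<open>R u\<close>.\<close>
      define \<rho> where "\<rho> z = (if z = Inl r then Inl r' else z)" for z :: "'e + 'a"
      have "(\<lambda>z\<in>?Z. (\<lambda>z\<in>?Z. u (shift \<gamma> {r} z)) (\<rho> z)) \<in> R u"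
        unfolding R_def
        using \<open>(\<lambda>z\<in>?Z. u (shift \<gamma> {r} z)) \<in> Sg ?Z (chips A E \<gamma> (Pow E - {{}}) v)\<close>
      proof (rule generated_reindex)
        show "\<rho> \<in> ?Z \<rightarrow> ?Z" using r'(1) by (auto simp: \<rho>_def)
        fix g assume "g \<in> chips A E \<gamma> (Pow E - {{}}) v"
        then obtain I where I: "I \<subseteq> E" "I \<noteq> {}" and g: "g = (\<lambda>z\<in>?Z. v (shift \<gamma> I z))"
          by (auto simp: chips_def)
        have "(\<lambda>z\<in>?Z. g (\<rho> z)) \<in> R u"
        proof (cases "r' \<in> I")
          case True
          \<comment> \<open>Both rows have the same parameter, so the result is again a chip of
            \<open>v\<close>.\<close>
          have "(\<lambda>z\<in>?Z. g (\<rho> z)) = (\<lambda>z\<in>?Z. v (shift \<gamma> (insert r I) z))"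
          proof (rule restrict_ext)
            fix z assume "z \<in> ?Z"
            then show "g (\<rho> z) = v (shift \<gamma> (insert r I) z)"
              using True r' same by (cases z) (auto simp: g \<rho>_def)
          qed
          then show ?thesis using chip_v[of "insert r I"] I r(1) by simp
        next
          case False
          define \<tau> where "\<tau> = \<sigma>(r := i)"
          have \<tau>: "good \<tau>" unfolding \<tau>_def using upd r k(1) by simp
          \<comment> \<open>Row \<open>r\<close> receives the entry of \<open>x\<close> at
            \<open>i'\<close>, which is that at \<open>i\<close>. So the result comes from
            \<open>\<tau>\<close>, which omits \<open>k\<close> instead of \<open>i\<close>. If
            \<open>I - {r}\<close> is empty, \<open>k \<notin> Bad\<close> puts it into
            \<open>R u\<close>; otherwise \<open>chip_sel\<close> does.\<close>
          have eq: "g (\<rho> z) = sel \<tau> x (shift \<gamma> (I - {r}) z)" if "z \<in> ?Z" for z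
          proof (cases "z = Inl r")
            case True
            then show ?thesis
              using False r(1) r' xi by (simp add: g \<rho>_def v_def sel_def \<tau>_def)
          next
            case z: False
            then have "shift \<gamma> (I - {r}) z = shift \<gamma> I z" by (cases z) auto
            moreover have "shift \<gamma> I z \<noteq> Inl r" using z by (cases z) auto
            moreover have "shift \<gamma> I z \<in> ?Z" using shift_in_Plus[OF \<gamma>, of I] that by blast
            ultimately show ?thesis
              using z that by (cases "shift \<gamma> I z") (auto simp: g \<rho>_def v_def sel_def \<tau>_def)
          qed
          show ?thesis
          proof (cases "I - {r} = {}")
            case True
            have "shift \<gamma> {} z = z" for z by (cases z) auto
            then have "(\<lambda>z\<in>?Z. g (\<rho> z)) = sel \<tau> x"
              using eq unfolding True by (intro ext) (simp add: sel_def)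
            moreover have "k \<notin> \<tau> ` E"
              using \<sigma> r k(2) \<open>i \<in> Bad\<close> by (auto simp: \<tau>_def good_def inj_on_def)
            ultimately show ?thesis using BadI[OF k(1) \<tau>] k(2) by auto
          next
            case False
            have "(\<lambda>z\<in>?Z. g (\<rho> z)) = (\<lambda>z\<in>?Z. sel \<tau> x (shift \<gamma> (I - {r}) z))"
              using eq by (rule restrict_ext)
            then show ?thesis using chip_sel[OF x_R' \<tau> _ False] I by auto
          qed
        qed
        then show "(\<lambda>z\<in>?Z. g (\<rho> z)) \<in> Sg ?Z (chips A E \<gamma> (Pow E - {{}}) u)" unfolding R_def .
      qed
      also have "(\<lambda>z\<in>?Z. (\<lambda>z\<in>?Z. u (shift \<gamma> {r} z)) (\<rho> z)) = u"
      proof (rule extensionalityI)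
        show "u \<in> extensional ?Z" using u by (simp add: PiE_iff)
        fix z assume "z \<in> ?Z"
        then show "(\<lambda>z\<in>?Z. (\<lambda>z\<in>?Z. u (shift \<gamma> {r} z)) (\<rho> z)) z = u z"
          using r'(1) \<open>r \<noteq> r'\<close> same by (cases z) (auto simp: \<rho>_def)
      qed simp
      finally show False using u_notin by simp
    qed
  qed

  have "u' \<notin> R'"
  proof
    assume "u' \<in> R'"
    moreover have "good Some"
      using u'_Inl by (auto simp: good_def E'_def \<gamma>'_def)
    moreover have "u' (Inl None) = u' (Inl (Some j0))"
      using same_class[of None] same_class[of "Some j0"] j0 by (auto simp: J'_def)
    ultimately have "sel Some u' \<in> R u"
      using main[of u' Some None "Some j0"] j0 by (auto simp: J'_def)
    also have "sel Some u' = u"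
    proof (rule extensionalityI)
      show "u \<in> extensional ?Z" using u by (simp add: PiE_iff)
      fix z assume "z \<in> ?Z"
      then show "sel Some u' z = u z" by (cases z) (auto simp: sel_def u'_def E'_def)
    qed (simp add: sel_def)
    finally show False using u_notin by simp
  qed
  then have "elusive E' \<gamma>' (Pow E' - {{}}) u'" using \<gamma>' u' by (simp add: elusive_def R'_def)
  then show ?thesis using E' by blast
qed

end

section \<open>A cube term of least dimension\<close>

theorem theorem36:
  fixes A :: "nat set" and S :: "'s set" and ar :: "'s \<Rightarrow> nat"
    and f :: "'s \<Rightarrow> (nat \<Rightarrow> nat) \<Rightarrow> nat" and m :: nat
  assumes "is_algebra A S ar f"
    and "finite A" and "A = {1..card A}"
    and "finite S" and "S \<noteq> {}"
    and "m = Max (ar ` S)" and "m \<ge> 1"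
  shows "has_cube_term A S ar f \<longleftrightarrow>
    (\<exists>d \<le> card A ^ 3 * m. has_cube_term_dim A S ar f d)"
proof
  interpret algebra A S ar f using assms(1) by unfold_locales
  assume "has_cube_term A S ar f"
  then have "\<exists>d. has_cube_term_dim A S ar f d" by (simp add: has_cube_term_def)
  then obtain d where d: "has_cube_term_dim A S ar f d"
    and d_min: "\<And>d'. d' < d \<Longrightarrow> \<not> has_cube_term_dim A S ar f d'"
    using exists_least_iff[of "has_cube_term_dim A S ar f"] by blast
  have "d \<le> card A ^ 3 * m"
  proof (rule ccontr)
    assume large: "\<not> d \<le> card A ^ 3 * m"
    \<comment> \<open>One less than the least dimension: \<open>N\<close> still reaches the bound,
      which is positive, so \<open>N \<ge> 1\<close>.\<close>
    define N where "N = d - 1"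
    have "A \<noteq> {}" using assms(1) by (simp add: is_algebra_def)
    then have "card A ^ 3 * m \<ge> 1" using assms(2,7) by (simp add: Suc_le_eq card_gt_0_iff)
    then have N: "N \<ge> 1" "d = Suc N" "N \<ge> card A ^ 3 * m" using large unfolding N_def by linarith+
    define E where "E = (A \<times> A) \<times> {1..N}"
    define u where "u = (\<lambda>z\<in>E <+> A. case z of Inl x \<Rightarrow> fst (fst x) | Inr a \<Rightarrow> a)"
    have "\<not> has_cube_term_dim A S ar f N" using d_min N(2) by simp
    then have "elusive E (snd \<circ> fst) (cols E snd N) u"
      unfolding E_def u_def using N(1) by (rule not_cube_term_imp_elusive)
    moreover have "u (Inr a) = a" if "a \<in> A" for a using that by (simp add: u_def)
    moreover have "finite E" using assms(2) by (simp add: E_def)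
    ultimately obtain E' \<gamma>' u' where E': "E' \<subseteq> E" "inj_on snd E'" "elusive E' \<gamma>' (cols E' snd N) u'"
      using elusive_imp_inj_on_cols[of E "snd \<circ> fst" snd N u] by blast
    \<comment> \<open>For an empty column, the empty set of rows could be chipped, and
      \<open>u'\<close> would be its own chip.\<close>
    have "snd ` E' = {1..N}"
    proof (rule ccontr)
      assume "snd ` E' \<noteq> {1..N}"
      moreover have "snd ` E' \<subseteq> {1..N}" using E'(1) by (auto simp: E_def)
      ultimately obtain i where i: "i \<in> {1..N}" "i \<notin> snd ` E'" by blast
      then have "{} = {x\<in>E'. snd x \<in> {i}}" using i(2) by blast
      then have "{} \<in> cols E' snd N" using i(1) unfolding cols_def by blast
      moreover have "shift \<gamma>' {} z = z" for z by (cases z) auto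
      ultimately have "restrict u' (E' <+> A) \<in> chips A E' \<gamma>' (cols E' snd N) u'"
        unfolding chips_def by (auto intro!: image_eqI[of _ _ "{}"])
      moreover have "restrict u' (E' <+> A) = u'" using E'(3) by (auto simp: elusive_def PiE_iff extensional_restrict)
      ultimately have "u' \<in> generated S ar f (E' <+> A) (chips A E' \<gamma>' (cols E' snd N) u')"
        by (intro generated.gen) simp
      then show False using E'(3) by (simp add: elusive_def)
    qed
    then have "card E' = N" using card_image[OF E'(2)] by simp
    \<comment> \<open>With exactly one row in each column, every nonempty set of rows is a union of
      columns.\<close>
    have "cols E' snd N = Pow E' - {{}}"
    proof (intro equalityI subsetI)
      fix X assume "X \<in> cols E' snd N"
      then obtain I where I: "X = {x\<in>E'. snd x \<in> I}" "I \<subseteq> {1..N}" "I \<noteq> {}"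
        unfolding cols_def by (elim imageE) simp
      then obtain i where "i \<in> I" "i \<in> snd ` E'" using \<open>snd ` E' = {1..N}\<close> by blast
      then show "X \<in> Pow E' - {{}}" unfolding I(1) by blast
    next
      fix X assume X: "X \<in> Pow E' - {{}}"
      have "X = {x\<in>E'. snd x \<in> snd ` X}"
        using X E'(2) by (blast dest: inj_onD)
      moreover have "snd ` X \<in> Pow {1..N} - {{}}"
        using X unfolding \<open>snd ` E' = {1..N}\<close>[symmetric] by blast
      ultimately show "X \<in> cols E' snd N" unfolding cols_def by (rule image_eqI)
    qed
    then have "elusive E' \<gamma>' (Pow E' - {{}}) u'" using E'(3) by simp
    moreover have "finite E'" using E'(1) \<open>finite E\<close> by (rule finite_subset)
    moreover have "ar s \<le> m" if "s \<in> S" for s using that assms(4,6) by simp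
    ultimately obtain E'' :: "((nat \<times> nat) \<times> nat) option set" and \<gamma>'' u'' where
      "finite E''" "card E'' = d" "elusive E'' \<gamma>'' (Pow E'' - {{}}) u''"
      using elusive_add_row[of E' \<gamma>' u' m] assms(2,7) N(2,3) \<open>card E' = N\<close> by auto
    then show False using cube_term_imp_not_elusive[OF d] by blast
  qed
  then show "\<exists>d \<le> card A ^ 3 * m. has_cube_term_dim A S ar f d" using d by blast
next
  assume "\<exists>d \<le> card A ^ 3 * m. has_cube_term_dim A S ar f d"
  then show "has_cube_term A S ar f" by (auto simp: has_cube_term_def)
qed

end
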